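(* There exist two cospectral trees with twelve vertices, each having characteristic polynomial $x^{12}-11x^{10}+42x^8-66x^6+39x^4-6x^2$, such that one of them is even and the other is odd.
   Context: The characteristic polynomial of a tree is the characteristic polynomial of its adjacency matrix. Two non-isomorphic trees with the same characteristic polynomial are called cospectral. Parity: a pr-tree (plane rooted tree) is a finite tree embedded in the plane with a chosen root vertex and a marked edge at the root; equivalently, a rooted tree in which the children of every vertex are linearly ordered from left to right. The bracket code of a pr-tree whose root has pr-subtrees $T_1,\dots,T_s$ (left to right) is recursively $(\,c(T_1)\cdots c(T_s)\,)$, where $c(T_i)$ is the code of $T_i$, and the one-vertex tree has code $()$. An inversion in a bracket code is a pair consisting of a closing bracket and an opening bracket, not necessarily adjacent, such that the closing bracket occurs before the opening bracket. A pr-tree is even if the number of inversions in its bracket code is even, and odd otherwise. For a tree with an even number of vertices this parity does not depend on the choice of root vertex, marked edge and plane embedding, so one speaks of even and odd trees. *)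

theory Defs
  imports Jordan_Normal_Form.Char_Poly Graph_Theory.Graph_Theory
begin

text \<open>
  Simple graphs are the loop-free finite symmetric digraphs (\<open>pair_graph\<close>) of the graph
  library. The library constants \<open>forest\<close> and \<open>tree\<close> forbid directed cycles and so reject every
  symmetric digraph with an edge, since u, v, u counts as a directed cycle. Undirected cycles are
  exactly the directed cycles of length at least three.
\<close>

definition undirected_tree :: "'a pair_pre_digraph \<Rightarrow> bool" where
  "undirected_tree G \<longleftrightarrow>
     pair_graph G \<and> connected (with_proj G) \<and>
     (\<nexists>p. pre_digraph.cycle (with_proj G) p \<and> 3 \<le> length p)"

text \<open>The vertices index rows and columns in increasing order.\<close>

definition adjacency_matrix :: "'a::linorder pair_pre_digraph \<Rightarrow> int mat" where
  "adjacency_matrix G =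
     (let vs = sorted_list_of_set (pverts G); n = length vs
      in Matrix.mat n n (\<lambda>(i, j). if (vs ! i, vs ! j) \<in> parcs G then 1 else 0))"

definition graph_char_poly :: "'a::linorder pair_pre_digraph \<Rightarrow> int poly" where
  "graph_char_poly G = char_poly (adjacency_matrix G)"

definition cospectral_trees ::
    "'a::linorder pair_pre_digraph \<Rightarrow> 'b::linorder pair_pre_digraph \<Rightarrow> bool" where
  "cospectral_trees G H \<longleftrightarrow>
     undirected_tree G \<and> undirected_tree H \<and>
     \<not> digraph_iso (with_proj G) (with_proj H) \<and>
     graph_char_poly G = graph_char_poly H"

text \<open>Plane rooted trees: the list holds the subtrees at the root from left to right.\<close>

datatype pr_tree = Node "pr_tree list"

datatype bracket = Opening | Closing

primrec bracket_code :: "pr_tree \<Rightarrow> bracket list" where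
  "bracket_code (Node ts) = Opening # concat (map bracket_code ts) @ [Closing]"

definition inversions :: "bracket list \<Rightarrow> (nat \<times> nat) set" where
  "inversions w = {(i, j). i < j \<and> j < length w \<and> w ! i = Closing \<and> w ! j = Opening}"

definition even_pr_tree :: "pr_tree \<Rightarrow> bool" where
  "even_pr_tree t \<longleftrightarrow> even (card (inversions (bracket_code t)))"

text \<open>
  A vertex of a plane rooted tree is addressed by the list of child indices on the way to it from
  the root.
\<close>

function addresses :: "pr_tree \<Rightarrow> nat list set" where
  "addresses (Node ts) = insert [] (\<Union>i\<in>{..<length ts}. (#) i ` addresses (ts ! i))"
  by pat_completeness auto
termination
  by (relation "measure size") (auto simp: less_Suc_eq_le intro: size_list_estimation'[OF nth_mem])

definition underlying_graph :: "pr_tree \<Rightarrow> nat list pair_pre_digraph" where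
  "underlying_graph t =
     \<lparr> pverts = addresses t,
       parcs = {(p, q). p \<in> addresses t \<and> q \<in> addresses t \<and>
                        (\<exists>i. q = p @ [i] \<or> p = q @ [i])} \<rparr>"

text \<open>
  The choices of a root, a marked edge at it and a plane embedding of \<open>G\<close> correspond to the plane
  rooted trees whose underlying graph is isomorphic to \<open>G\<close>.
\<close>

definition plane_rooting :: "pr_tree \<Rightarrow> 'a pair_pre_digraph \<Rightarrow> bool" where
  "plane_rooting t G \<longleftrightarrow> digraph_iso (with_proj (underlying_graph t)) (with_proj G)"

text \<open>
  Evenness and oddness require the same parity for all choices. The existence of a choice is
  demanded as well, so that neither notion can hold vacuously.
\<close>

definition even_tree :: "'a pair_pre_digraph \<Rightarrow> bool" where
  "even_tree G \<longleftrightarrow>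
     (\<exists>t. plane_rooting t G) \<and> (\<forall>t. plane_rooting t G \<longrightarrow> even_pr_tree t)"

definition odd_tree :: "'a pair_pre_digraph \<Rightarrow> bool" where
  "odd_tree G \<longleftrightarrow>
     (\<exists>t. plane_rooting t G) \<and> (\<forall>t. plane_rooting t G \<longrightarrow> \<not> even_pr_tree t)"

end

(*
  Two brackets of a code form an inversion exactly when they come from two vertices neither of which
  is an ancestor of the other. A tree with n vertices thus has C(n,2) - D inversions, where D is the
  sum of all depths, and D has the parity of the number of vertices at odd depth. For even n both
  classes of the bipartition have the same parity, so the parity of a tree is that of C(n,2) plus
  the size of one class. The two trees were found by enumeration: both have the required
  characteristic polynomial, while their classes have sizes (6, 6) and (5, 7). Having different
  parities, they are not isomorphic.
*)
theory Submission
  imports Defs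
begin

section \<open>Inversions and depths\<close>

text \<open>A bracket put in front can only be the closing half of an inversion, so it pairs exactly
  with the opening brackets of \<open>w\<close>.\<close>

lemma card_inversions_Cons:
  "card (inversions (b # w)) =
     (if b = Closing then count_list w Opening else 0) + card (inversions w)"
proof -
  let ?Z = "if b = Closing then (\<lambda>j. (0::nat, Suc j)) ` {j. j < length w \<and> w ! j = Opening} else {}"
  have fin: "finite (inversions v)" for v
    by (rule finite_subset[of _ "{..<length v} \<times> {..<length v}"]) (auto simp: inversions_def)
  have "(i, j) \<in> inversions (b # w) \<longleftrightarrow> (i, j) \<in> ?Z \<union> map_prod Suc Suc ` inversions w" for i j
    by (cases i; cases j) (auto simp: inversions_def)
  then have "inversions (b # w) = ?Z \<union> map_prod Suc Suc ` inversions w"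
    by auto
  moreover have "card (map_prod Suc Suc ` inversions w) = card (inversions w)"
    by (rule card_image) (auto simp: inj_on_def)
  moreover have "card ?Z = (if b = Closing then count_list w Opening else 0)"
    by (auto simp: card_image inj_on_def count_list_eq_length_filter length_filter_conv_card
        intro!: arg_cong[of _ _ card])
  moreover have "card (?Z \<union> map_prod Suc Suc ` inversions w) =
      card ?Z + card (map_prod Suc Suc ` inversions w)"
    by (rule card_Un_disjoint) (auto simp: fin)
  ultimately show ?thesis
    by simp
qed

lemma card_inversions_append:
  "card (inversions (v @ w)) =
     card (inversions v) + card (inversions w) + count_list v Closing * count_list w Opening"
  by (induction v) (auto simp: card_inversions_Cons, simp add: inversions_def)

text \<open>The outer pair opens first and closes last, so neither of its brackets takes part in an
  inversion.\<close>

lemma card_inversions_bracket_code_Node: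
  "card (inversions (bracket_code (Node ts))) = card (inversions (concat (map bracket_code ts)))"
  by (simp add: card_inversions_Cons card_inversions_append) (simp add: inversions_def)

lemma finite_addresses [simp]: "finite (addresses t)"
  by (induction t rule: addresses.induct) auto

text \<open>Kept general in \<open>f\<close>: the constant 1 gives the number of vertices,
  \<open>length\<close> the sum of the depths.\<close>

lemma sum_addresses_Node:
  fixes f :: "nat list \<Rightarrow> nat"
  shows "sum f (addresses (Node ts)) =
     f [] + (\<Sum>i<length ts. \<Sum>q\<in>addresses (ts ! i). f (i # q))"
proof -
  have "sum f (\<Union>i\<in>{..<length ts}. (#) i ` addresses (ts ! i)) =
      (\<Sum>i<length ts. sum f ((#) i ` addresses (ts ! i)))"
    by (rule sum.UNION_disjoint) auto
  also have "\<dots> = (\<Sum>i<length ts. \<Sum>q\<in>addresses (ts ! i). f (i # q))"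
    by (rule sum.cong) (simp_all add: sum.reindex)
  finally show ?thesis
    by (simp add: image_iff)
qed

lemma card_addresses_Node:
  "card (addresses (Node ts)) = Suc (\<Sum>t\<leftarrow>ts. card (addresses t))"
  unfolding card_eq_sum sum_addresses_Node by (simp add: sum_list_sum_nth atLeast0LessThan)

lemma sum_length_addresses_Node:
  "sum length (addresses (Node ts)) =
     (\<Sum>t\<leftarrow>ts. sum length (addresses t)) + (\<Sum>t\<leftarrow>ts. card (addresses t))"
  by (simp add: sum_addresses_Node sum_list_sum_nth atLeast0LessThan sum.distrib
      sum_Suc del: addresses.simps)

lemma count_list_concat: "count_list (concat xss) x = (\<Sum>xs\<leftarrow>xss. count_list xs x)"
  by (induction xss) auto

lemma count_list_bracket_code:
  "count_list (bracket_code t) b = card (addresses t)"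
proof (induction t)
  case (Node ts)
  then show ?case
    by (cases b) (simp_all add: count_list_concat card_addresses_Node comp_def cong: map_cong del: addresses.simps)
qed

lemma add_choose_two: "(m + n) choose 2 = (m choose 2) + (n choose 2) + m * n"
  by (induction m) (auto simp: numeral_2_eq_2)

text \<open>The product in \<open>add_choose_two\<close> counts the mixed inversions between
  subtrees, since a subtree has as many brackets of either kind as vertices. A new root pushes the m
  vertices below it one level down, and C(m+1,2) - C(m,2) = m.\<close>

lemma card_inversions_bracket_code:
  "card (inversions (bracket_code t)) + sum length (addresses t) = card (addresses t) choose 2"
proof (induction t)
  case (Node ts)
  \<comment> \<open>The same identity for the forest below the root, with depths measured inside
    each subtree.\<close>
  then have "card (inversions (concat (map bracket_code ts))) + (\<Sum>t\<leftarrow>ts. sum length (addresses t)) =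
      (\<Sum>t\<leftarrow>ts. card (addresses t)) choose 2"
  proof (induction ts)
    case Nil
    then show ?case
      by (simp add: inversions_def)
  next
    case (Cons t ts)
    then have "card (inversions (concat (map bracket_code ts))) + (\<Sum>t\<leftarrow>ts. sum length (addresses t)) =
        (\<Sum>t\<leftarrow>ts. card (addresses t)) choose 2"
      by simp
    moreover from Cons have "card (inversions (bracket_code t)) + sum length (addresses t) = card (addresses t) choose 2"
      by simp
    ultimately show ?case
      by (simp add: card_inversions_append add_choose_two count_list_concat count_list_bracket_code
          comp_def)
  qed
  then show ?case
    by (simp add: card_inversions_bracket_code_Node sum_length_addresses_Node card_addresses_Node
        numeral_2_eq_2 del: addresses.simps bracket_code.simps)
qed

section \<open>Isomorphisms and plane rootings\<close>

text \<open>An arc of a pair digraph is the pair of its ends, so the vertex map determines the arc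
  map, and tail and head must be the projections.\<close>

lemma digraph_iso_with_proj_iff:
  "digraph_iso (with_proj G) (with_proj H) \<longleftrightarrow>
     pair_wf_digraph G \<and>
     (\<exists>h. inj_on h (pverts G) \<and> pverts H = h ` pverts G \<and> parcs H = map_prod h h ` parcs G)"
  (is "_ \<longleftrightarrow> _ \<and> (\<exists>h. ?iso h)")
proof
  assume "digraph_iso (with_proj G) (with_proj H)"
  then obtain f where f: "pre_digraph.digraph_isomorphism (with_proj G) f"
    and H: "with_proj H = app_iso f (with_proj G)"
    by (auto simp: digraph_iso_def)
  have "iso_tail f = fst" "iso_head f = snd" "pverts H = iso_verts f ` pverts G"
    "parcs H = iso_arcs f ` parcs G"
    using arg_cong[OF H, of tail] arg_cong[OF H, of head] arg_cong[OF H, of verts]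
      arg_cong[OF H, of arcs] by simp_all
  moreover from this have "iso_arcs f a = map_prod (iso_verts f) (iso_verts f) a"
    if "a \<in> parcs G" for a
    using f that by (auto simp: pre_digraph.digraph_isomorphism_def prod_eq_iff)
  moreover have "wf_digraph (with_proj G)" "inj_on (iso_verts f) (pverts G)"
    using f by (auto simp: pre_digraph.digraph_isomorphism_def)
  ultimately show "pair_wf_digraph G \<and> (\<exists>h. ?iso h)"
    by (auto simp: wf_digraph_wp_iff intro!: exI[of _ "iso_verts f"])
next
  assume "pair_wf_digraph G \<and> (\<exists>h. ?iso h)"
  then obtain h where G: "pair_wf_digraph G" and h: "?iso h" by blast
  interpret pair_wf_digraph G by (rule G)
  have "inj_on (map_prod h h) (parcs G)"
    using h in_arcsD1 in_arcsD2 by (auto simp: inj_on_def)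
  then have "digraph_isomorphism
      \<lparr>iso_verts = h, iso_arcs = map_prod h h, iso_head = snd, iso_tail = fst\<rparr>"
    using h wf_digraph_axioms by (auto simp: digraph_isomorphism_def)
  moreover have "with_proj H = app_iso
      \<lparr>iso_verts = h, iso_arcs = map_prod h h, iso_head = snd, iso_tail = fst\<rparr> (with_proj G)"
    using h by (simp add: app_iso_def with_proj_def)
  ultimately show "digraph_iso (with_proj G) (with_proj H)"
    unfolding digraph_iso_def by blast
qed

lemma plane_rooting_digraph_iso:
  assumes "plane_rooting t G" "digraph_iso (with_proj G) (with_proj H)"
  shows "plane_rooting t H"
proof -
  obtain g where wf: "pair_wf_digraph (underlying_graph t)"
    and g: "inj_on g (pverts (underlying_graph t))" "pverts G = g ` pverts (underlying_graph t)"
      "parcs G = map_prod g g ` parcs (underlying_graph t)"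
    using assms(1) unfolding plane_rooting_def digraph_iso_with_proj_iff by blast
  obtain h where h: "inj_on h (pverts G)" "pverts H = h ` pverts G"
      "parcs H = map_prod h h ` parcs G"
    using assms(2) unfolding digraph_iso_with_proj_iff by blast
  have "inj_on (h \<circ> g) (pverts (underlying_graph t))"
    using g(1,2) h(1) by (simp add: comp_inj_on)
  moreover have "parcs H = map_prod (h \<circ> g) (h \<circ> g) ` parcs (underlying_graph t)"
    unfolding g(3) h(3) image_image by (intro image_cong refl) auto
  moreover have "pverts H = (h \<circ> g) ` pverts (underlying_graph t)"
    unfolding g(2) h(2) image_comp ..
  ultimately show ?thesis
    unfolding plane_rooting_def digraph_iso_with_proj_iff using wf by blast
qed

text \<open>An isomorphism would carry a plane rooting of \<open>G\<close> over to \<open>H\<close>,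
  and this rooting would have both parities.\<close>

lemma not_digraph_iso_even_odd:
  assumes "even_tree G" "odd_tree H"
  shows "\<not> digraph_iso (with_proj G) (with_proj H)"
proof
  assume iso: "digraph_iso (with_proj G) (with_proj H)"
  obtain t where "plane_rooting t G"
    using assms(1) unfolding even_tree_def by blast
  moreover from this iso have "plane_rooting t H"
    by (rule plane_rooting_digraph_iso)
  ultimately show False
    using assms unfolding even_tree_def odd_tree_def by blast
qed

section \<open>Parity from a proper 2-colouring\<close>

text \<open>\<open>card_inversions_bracket_code\<close> leaves the sum of the depths, which has the
  parity of the number of its odd summands.\<close>

lemma even_pr_tree_iff:
  "even_pr_tree t \<longleftrightarrow>
     (even (card (addresses t) choose 2) \<longleftrightarrow> even (card {q \<in> addresses t. odd (length q)}))"
proof -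
  have "even (sum length (addresses t)) \<longleftrightarrow> even (card {q \<in> addresses t. odd (length q)})"
    by (rule even_sum_iff) simp
  then show ?thesis
    unfolding even_pr_tree_def card_inversions_bracket_code[symmetric] by auto
qed

text \<open>Lets \<open>rev_induct\<close> on an address descend from the root.\<close>

lemma addresses_snoc:
  assumes "q @ [i] \<in> addresses t"
  shows "q \<in> addresses t"
  using assms
proof (induction q arbitrary: t)
  case Nil
  then show ?case by (cases t) simp
next
  case (Cons j q)
  then show ?case by (cases t) auto
qed

text \<open>Colours alternate along the levels, so the vertices at odd depth form the class not
  containing the root, whatever the rooting.\<close>

lemma even_pr_tree_plane_rooting_iff:
  fixes c :: "'a \<Rightarrow> bool"
  assumes rooting: "plane_rooting t G"
    and proper: "\<And>u v. (u, v) \<in> parcs G \<Longrightarrow> c u \<noteq> c v"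
    and even_card: "even (card (pverts G))"
  shows "even_pr_tree t \<longleftrightarrow>
     (even (card (pverts G) choose 2) \<longleftrightarrow> even (card {v \<in> pverts G. c v}))"
proof -
  obtain h where h: "inj_on h (addresses t)" "pverts G = h ` addresses t"
    and arcs: "parcs G = map_prod h h ` parcs (underlying_graph t)"
    using rooting unfolding plane_rooting_def digraph_iso_with_proj_iff
    by (auto simp: underlying_graph_def)
  have colour: "c (h q) \<longleftrightarrow> (c (h []) \<longleftrightarrow> even (length q))" if "q \<in> addresses t" for q
    using that
  proof (induction q rule: rev_induct)
    case (snoc i q)
    then have q: "q \<in> addresses t"
      by (blast intro: addresses_snoc)
    with snoc.prems have "(q, q @ [i]) \<in> parcs (underlying_graph t)"
      by (simp add: underlying_graph_def)
    then have "(h q, h (q @ [i])) \<in> parcs G"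
      unfolding arcs by (force simp: image_iff)
    with proper snoc.IH[OF q] show ?case
      by auto
  qed simp
  have card: "card (pverts G) = card (addresses t)"
    using h by (simp add: card_image)
  have image: "{v \<in> pverts G. P v} = h ` {q \<in> addresses t. P (h q)}" for P
    using h by auto
  have card_class: "card {v \<in> pverts G. P v} = card {q \<in> addresses t. P (h q)}" for P
    unfolding image by (rule card_image) (use h in \<open>auto intro: inj_on_subset\<close>)
  have "card {v \<in> pverts G. c v} + card {v \<in> pverts G. \<not> c v} = card (pverts G)"
    by (subst card_Un_disjoint[symmetric]) (auto simp: h intro!: arg_cong[of _ _ card])
  \<comment> \<open>For even order the two classes agree in parity, so the colour of the root does
    not matter.\<close>
  with even_card have "even (card {v \<in> pverts G. \<not> c v}) \<longleftrightarrow> even (card {v \<in> pverts G. c v})"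
    by (metis even_add)
  then have "even (card {v \<in> pverts G. c v \<noteq> c (h [])}) \<longleftrightarrow> even (card {v \<in> pverts G. c v})"
    by (cases "c (h [])") simp_all
  moreover have "{q \<in> addresses t. c (h q) \<noteq> c (h [])} = {q \<in> addresses t. odd (length q)}"
    using colour by auto
  ultimately show ?thesis
    unfolding even_pr_tree_iff card card_class[of "\<lambda>v. c v \<noteq> c (h [])"] by simp
qed

text \<open>The criterion does not mention \<open>t\<close>: a single colouring settles all plane
  rootings at once, while \<open>t\<close> witnesses that one exists.\<close>

lemma
  fixes c :: "'a \<Rightarrow> bool"
  assumes "plane_rooting t G" "\<And>u v. (u, v) \<in> parcs G \<Longrightarrow> c u \<noteq> c v" "even (card (pverts G))"
  shows even_tree_iff: "even_tree G \<longleftrightarrow>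
      (even (card (pverts G) choose 2) \<longleftrightarrow> even (card {v \<in> pverts G. c v}))" (is ?even)
    and odd_tree_iff: "odd_tree G \<longleftrightarrow>
      \<not> (even (card (pverts G) choose 2) \<longleftrightarrow> even (card {v \<in> pverts G. c v}))" (is ?odd)
proof -
  note parity = even_pr_tree_plane_rooting_iff[of _ G c, OF _ assms(2,3)]
  show ?even ?odd
    unfolding even_tree_def odd_tree_def using parity assms(1) by blast+
qed

section \<open>Trees given by a parent function\<close>

text \<open>The root is 0, and the value of a parent function there is irrelevant.\<close>

definition parent_function :: "nat \<Rightarrow> (nat \<Rightarrow> nat) \<Rightarrow> bool" where
  "parent_function n p \<longleftrightarrow> (\<forall>i. 0 < i \<and> i < n \<longrightarrow> p i < i)"
text \<open>Numbering parents before children serves three times: for connectedness by induction,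
  for acyclicity by a largest vertex, and as elimination order.\<close>

definition parent_tree :: "nat \<Rightarrow> (nat \<Rightarrow> nat) \<Rightarrow> nat pair_pre_digraph" where
  "parent_tree n p =
     \<lparr> pverts = {..<n},
       parcs = {(i, j). i < n \<and> j < n \<and> (0 < i \<and> j = p i \<or> 0 < j \<and> i = p j)} \<rparr>"

lemma pair_graph_parent_tree:
  assumes "parent_function n p"
  shows "pair_graph (parent_tree n p)"
proof -
  have arc: "fst e < n \<and> snd e < n \<and> fst e \<noteq> snd e" if "e \<in> parcs (parent_tree n p)" for e
    using that assms by (auto simp: parent_tree_def parent_function_def)
  moreover have "finite (parcs (parent_tree n p))"
    by (rule finite_subset[of _ "{..<n} \<times> {..<n}"]) (auto simp: parent_tree_def)
  moreover have "symmetric (with_proj (parent_tree n p))"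
    by (auto simp: symmetric_def sym_def parent_tree_def)
  moreover have "pverts (parent_tree n p) = {..<n}"
    by (simp add: parent_tree_def)
  ultimately show ?thesis
    by unfold_locales simp_all
qed

lemma connected_parent_tree:
  assumes "parent_function n p" "0 < n"
  shows "connected (with_proj (parent_tree n p))"
proof -
  interpret G: pair_graph "parent_tree n p"
    using assms by (intro pair_graph_parent_tree)
  have sym: "parcs (mk_symmetric (with_proj (parent_tree n p))) = parcs (parent_tree n p)"
    using G.adj_mk_symmetric_eq[OF G.pair_sym_arcs] by simp
  have verts: "pverts (parent_tree n p) = {..<n}"
    by (simp add: parent_tree_def)
  have from0: "0 \<rightarrow>\<^sup>*\<^bsub>with_proj (parent_tree n p)\<^esub> i" if "i < n" for i
    using that
  proof (induction i rule: less_induct)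
    case (less i)
    show ?case
    proof (cases "i = 0")
      case True
      then show ?thesis using assms verts by simp
    next
      case False
      then have "p i < i" using assms less.prems by (simp add: parent_function_def)
      then have "(p i, i) \<in> parcs (parent_tree n p)"
        using False less.prems by (simp add: parent_tree_def)
      with less \<open>p i < i\<close> show ?thesis
        by (meson G.reachable_adj_trans less.IH less_trans)
    qed
  qed
  then have "u \<rightarrow>\<^sup>*\<^bsub>with_proj (parent_tree n p)\<^esub> v" if "u < n" "v < n" for u v
    using that G.reachable_trans[OF symmetric_reachable[OF G.pair_sym_arcs]] by blast
  \<comment> \<open>\<open>connected\<close> refers to the symmetrised graph; reachability is the
    same there because the arcs are symmetric already.\<close>
  then have "u \<rightarrow>\<^sup>*\<^bsub>with_proj (mk_symmetric (with_proj (parent_tree n p)))\<^esub> v"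
    if "u < n" "v < n" for u v
    using that G.reachable_mk_symmetric_eq[OF G.pair_sym_arcs] by blast
  then show ?thesis
    unfolding connected_def strongly_connected_def using verts assms by auto
qed

section \<open>Acyclicity\<close>

text \<open>Indexed access to a walk, needed to speak of the two neighbours of a vertex on a
  cycle.\<close>

lemma pcas_nth:
  assumes "pcas u es v" "k < length es"
  shows "es ! k = (pawalk_verts u es ! k, pawalk_verts u es ! Suc k)"
  using assms
proof (induction es arbitrary: u k)
  case (Cons e es)
  then have "pawalk_verts (snd e) es ! 0 = snd e"
    by (cases es) auto
  with Cons show ?case
    by (cases k) (auto simp: prod_eq_iff)
qed simp

lemma pcas_pawalk_verts_ends:
  assumes "pcas u es v"
  shows "pawalk_verts u es ! 0 = u" "pawalk_verts u es ! length es = v"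
proof -
  show "pawalk_verts u es ! 0 = u"
    using assms by (cases es) auto
  show "pawalk_verts u es ! length es = v"
    using assms by (induction es arbitrary: u) auto
qed

lemma length_pawalk_verts: "length (pawalk_verts u es) = Suc (length es)"
  by (induction es arbitrary: u) auto

text \<open>Every arc joins a vertex to its smaller parent, so a neighbour not above
  \<open>m\<close> can only be \<open>p m\<close>.\<close>

lemma parent_tree_larger_neighbour_unique:
  assumes "parent_function n p"
    and "(i, m) \<in> parcs (parent_tree n p)" "(m, j) \<in> parcs (parent_tree n p)" "i \<le> m" "j \<le> m"
  shows "i = j"
proof -
  have "p i < i" if "0 < i" "i < n" for i
    using assms(1) that by (simp add: parent_function_def)
  from this[of i] this[of j] show ?thesis
    using assms(2-) by (auto simp: parent_tree_def)
qed

text \<open>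
  On a cycle of length at least three, the largest vertex has two distinct neighbours, and both
  would be its parent.
\<close>

lemma no_long_cycle_parent_tree:
  assumes "parent_function n p" "pre_digraph.cycle (with_proj (parent_tree n p)) es"
  shows "length es < 3"
proof (rule ccontr)
  assume "\<not> length es < 3"
  define L where "L = length es"
  have L: "3 \<le> L" using \<open>\<not> length es < 3\<close> by (simp add: L_def)
  obtain u where arcs: "set es \<subseteq> parcs (parent_tree n p)" and walk: "pcas u es u"
    and dist: "distinct (tl (pawalk_verts u es))"
    using assms(2) unfolding pre_digraph.cycle_def pre_digraph.awalk_def
      cas_with_proj_eq awalk_verts_with_proj_eq by auto
  define v where "v k = pawalk_verts u es ! k" for k
  have v_arc: "(v k, v (Suc k)) \<in> parcs (parent_tree n p)" if "k < L" for k
    using pcas_nth[OF walk, of k] arcs that nth_mem[of k es] by (auto simp: v_def L_def)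
  have v_closed: "v 0 = v L"
    using pcas_pawalk_verts_ends[OF walk] by (simp add: v_def L_def)
  \<comment> \<open>Positions 1 to \<open>L\<close> run through the cycle once; position 0 repeats
    position \<open>L\<close>.\<close>
  have v_inj: "j = k" if "v j = v k" "1 \<le> j" "j \<le> L" "1 \<le> k" "k \<le> L" for j k
  proof -
    have "tl (pawalk_verts u es) ! (j - 1) = tl (pawalk_verts u es) ! (k - 1)"
      using that by (simp add: v_def L_def nth_tl length_pawalk_verts)
    then have "j - 1 = k - 1"
      using that dist by (subst (asm) nth_eq_iff_index_eq) (auto simp: L_def length_pawalk_verts)
    then show ?thesis using that by simp
  qed
  define m where "m = Max (v ` {1..L})"
  have "m \<in> v ` {1..L}" unfolding m_def using L by (intro Max_in) auto
  then obtain k where k: "v k = m" "1 \<le> k" "k \<le> L" by auto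
  have v_le: "v j \<le> v k" if "1 \<le> j" "j \<le> L" for j
    using that k by (auto simp: m_def)
  \<comment> \<open>The positions before and after \<open>k\<close>, wrapped around within 1 to
    \<open>L\<close>; they differ because \<open>L\<close> is at least 3.\<close>
  define i where "i = (if k = 1 then L else k - 1)"
  define j where "j = (if k = L then 1 else Suc k)"
  have i: "1 \<le> i" "i \<le> L" and j: "1 \<le> j" "j \<le> L"
    using k L by (auto simp: i_def j_def)
  have "(v i, v k) \<in> parcs (parent_tree n p)"
    using v_arc[of "k - 1"] k v_closed by (auto simp: i_def)
  moreover have "(v k, v j) \<in> parcs (parent_tree n p)"
    using v_arc[of k] v_arc[of 0] k L v_closed by (auto simp: j_def)
  ultimately have "v i = v j"
    using assms(1) v_le i j by (intro parent_tree_larger_neighbour_unique) auto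
  then have "i = j" using v_inj i j by blast
  then show False using k L by (auto simp: i_def j_def split: if_splits)
qed

lemma undirected_tree_parent_tree:
  assumes "parent_function n p" "0 < n"
  shows "undirected_tree (parent_tree n p)"
  unfolding undirected_tree_def
proof (intro conjI notI)
  assume "\<exists>es. pre_digraph.cycle (with_proj (parent_tree n p)) es \<and> 3 \<le> length es"
  then obtain es where "pre_digraph.cycle (with_proj (parent_tree n p)) es" "3 \<le> length es"
    by blast
  then show False
    using no_long_cycle_parent_tree[OF assms(1), of es] by simp
qed (rule pair_graph_parent_tree[OF assms(1)], rule connected_parent_tree[OF assms])

section \<open>Plane rootings of parent trees\<close>

text \<open>Here \<open>a\<close> gives each vertex its address, and dropping the last index leads
  to the parent. The isomorphism wanted runs from addresses to vertices, hence is the inverse of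
  \<open>a\<close>.\<close>

lemma plane_rooting_parent_tree:
  assumes p: "parent_function n p"
    and bij: "bij_betw a {..<n} (addresses t)"
    and root: "a 0 = []"
    and step: "\<And>i. 0 < i \<Longrightarrow> i < n \<Longrightarrow> a i \<noteq> [] \<and> butlast (a i) = a (p i)"
  shows "plane_rooting t (parent_tree n p)"
proof -
  define h where "h = the_inv_into {..<n} a"
  have inj: "inj_on a {..<n}" and addr: "addresses t = a ` {..<n}"
    using bij by (auto simp: bij_betw_def)
  have h: "h (a i) = i" if "i < n" for i
    unfolding h_def using inj that by (simp add: the_inv_into_f_f)
  have p_less: "p i < n" if "0 < i" "i < n" for i
    using p that by (force simp: parent_function_def)
  have child: "(\<exists>k. a j = a i @ [k]) \<longleftrightarrow> 0 < j \<and> i = p j" if "i < n" "j < n" for i j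
  proof
    assume "\<exists>k. a j = a i @ [k]"
    then obtain k where k: "a j = a i @ [k]" by blast
    then have "0 < j" using root by (cases "j = 0") auto
    with step[of j] k that have "a i = a (p j)" by simp
    then show "0 < j \<and> i = p j"
      using inj_onD[OF inj] that p_less[of j] \<open>0 < j\<close> by auto
  next
    assume "0 < j \<and> i = p j"
    then show "\<exists>k. a j = a i @ [k]"
      using step[of j] that by (metis append_butlast_last_id)
  qed
  have edge: "(i, j) \<in> parcs (parent_tree n p) \<longleftrightarrow>
      i < n \<and> j < n \<and> (a i, a j) \<in> parcs (underlying_graph t)" for i j
  proof (cases "i < n \<and> j < n")
    case True
    then have "a i \<in> addresses t" "a j \<in> addresses t"
      by (simp_all add: addr)
    with True child[of i j] child[of j i] show ?thesis
      by (simp add: parent_tree_def underlying_graph_def ex_disj_distrib disj_commute)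
  qed (auto simp: parent_tree_def)
  have "parcs (underlying_graph t) = map_prod a a ` parcs (parent_tree n p)"
  proof (intro equalityI subsetI)
    fix e assume e: "e \<in> parcs (underlying_graph t)"
    then obtain i j where "i < n" "j < n" "e = (a i, a j)"
      by (auto simp: underlying_graph_def addr)
    with e edge[of i j] show "e \<in> map_prod a a ` parcs (parent_tree n p)"
      by (intro image_eqI[of _ _ "(i, j)"]) simp_all
  next
    fix e assume "e \<in> map_prod a a ` parcs (parent_tree n p)"
    then obtain i j where "(i, j) \<in> parcs (parent_tree n p)" "e = (a i, a j)"
      by auto
    with edge[of i j] show "e \<in> parcs (underlying_graph t)"
      by simp
  qed
  then have "map_prod h h ` parcs (underlying_graph t) =
      (\<lambda>e. map_prod h h (map_prod a a e)) ` parcs (parent_tree n p)"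
    by (simp only: image_image)
  also have "\<dots> = (\<lambda>e. e) ` parcs (parent_tree n p)"
    by (intro image_cong) (auto simp: parent_tree_def h)
  finally have "parcs (parent_tree n p) = map_prod h h ` parcs (underlying_graph t)"
    by simp
  moreover have "inj_on h (addresses t)"
    unfolding addr by (rule inj_onI) (auto simp: h)
  moreover have "h ` addresses t = {..<n}"
    unfolding addr image_image by (simp add: h)
  moreover have "pair_wf_digraph (underlying_graph t)"
    by unfold_locales (auto simp: underlying_graph_def)
  ultimately show ?thesis
    unfolding plane_rooting_def digraph_iso_with_proj_iff
    by (intro conjI exI[of _ h]) (auto simp: underlying_graph_def parent_tree_def)
qed

lemma parent_tree_proper_colouring:
  assumes "\<And>i. 0 < i \<Longrightarrow> i < n \<Longrightarrow> c i \<noteq> c (p i)" "(u, v) \<in> parcs (parent_tree n p)"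
  shows "c u \<noteq> c v"
proof -
  have "u < n" "v < n" "0 < u \<and> v = p u \<or> 0 < v \<and> u = p v"
    using assms(2) by (auto simp: parent_tree_def)
  then show ?thesis
    using assms(1)[of u] assms(1)[of v] by metis
qed

lemma plane_rooting_parent_tree_list:
  assumes "parent_function (length as) p" "distinct as" "addresses t = set as" "as ! 0 = []"
    and "\<And>i. 0 < i \<Longrightarrow> i < length as \<Longrightarrow> as ! i \<noteq> [] \<and> butlast (as ! i) = as ! p i"
  shows "plane_rooting t (parent_tree (length as) p)"
  using assms by (intro plane_rooting_parent_tree[where a = "(!) as"] bij_betw_nth) auto

section \<open>Characteristic polynomials by leaf elimination\<close>

text \<open>
  Eliminating the last leaf changes only the row of its parent, whose off-diagonal entries stay
  equal to each other up to zeros. No division occurs: once all proper descendants of \<open>i\<close> have been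
  eliminated, \<open>d i\<close> is the characteristic polynomial of the subtree at \<open>i\<close>, and \<open>s i\<close> that of this
  subtree without \<open>i\<close>.
\<close>

definition elimination_mat ::
    "nat \<Rightarrow> (nat \<Rightarrow> nat) \<Rightarrow> (nat \<Rightarrow> 'a) \<Rightarrow> (nat \<Rightarrow> 'a) \<Rightarrow> 'a::comm_ring_1 mat" where
  "elimination_mat n p d s =
     Matrix.mat n n (\<lambda>(i, j). if i = j then d i
       else if (i, j) \<in> parcs (parent_tree n p) then - s i else 0)"

text \<open>Among the vertices up to \<open>n\<close>, vertex \<open>n\<close> is a leaf, so its row
  and column meet only \<open>n\<close> and its parent. Clearing the parent's entry in the last
  column allows Laplace expansion there.\<close>

lemma det_elimination_mat_Suc:
  fixes d s :: "nat \<Rightarrow> 'a::idom"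
  assumes "parent_function m p" and "0 < n" and "n < m" and "d n \<noteq> 0"
  shows "det (elimination_mat (Suc n) p d s) =
     det (elimination_mat n p (d(p n := d n * d (p n) - s (p n) * s n)) (s(p n := d n * s (p n))))"
proof -
  define q where "q = p n"
  have p: "p i < i" if "0 < i" "i \<le> n" for i
    using assms that by (simp add: parent_function_def)
  then have q: "q < n" using \<open>0 < n\<close> by (simp add: q_def)
  let ?M = "elimination_mat (Suc n) p d s"
  let ?M' = "elimination_mat n p (d(q := d n * d q - s q * s n)) (s(q := d n * s q))"
  \<comment> \<open>Row \<open>q\<close> becomes \<open>d n\<close> times itself plus
    \<open>s q\<close> times row \<open>n\<close>; its last entry is then
    \<open>s q * d n - d n * s q = 0\<close>.\<close>
  define N where "N = addrow (s q) q n (multrow q (d n) ?M)"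
  have M: "?M \<in> carrier_mat (Suc n) (Suc n)" by (simp add: elimination_mat_def)
  then have N: "N \<in> carrier_mat (Suc n) (Suc n)" by (simp add: N_def)
  have "det N = d n * det ?M"
    unfolding N_def using q M by (subst det_addrow) (auto intro: det_multrow[OF less_SucI])
  moreover have "det N = d n * det ?M'"
  proof -
    have idx: "N $$ (i, j) = (if i = q then s q * ?M $$ (n, j) + d n * ?M $$ (q, j) else ?M $$ (i, j))"
      if "i < Suc n" "j < Suc n" for i j
      using that q M by (auto simp: N_def)
    have adj: "(i, j) \<in> parcs (parent_tree (Suc n) p) \<longleftrightarrow> (i, j) \<in> parcs (parent_tree n p)"
      if "i < n" "j < n" for i j
      using that by (simp add: parent_tree_def)
    have adj_last: "(n, i) \<in> parcs (parent_tree (Suc n) p) \<longleftrightarrow> i = q"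
      "(i, n) \<in> parcs (parent_tree (Suc n) p) \<longleftrightarrow> i = q" if "i < n" for i
      using that q p[of i] \<open>0 < n\<close> by (auto simp: parent_tree_def q_def)
    have last: "N $$ (i, n) = (if i = n then d n else 0)" if "i < Suc n" for i
      unfolding idx[OF that lessI] using that q
      by (cases "i = n") (auto simp: elimination_mat_def adj_last mult.commute)
    have "mat_delete N n n = ?M'"
    proof (rule eq_matI)
      fix i j assume "i < dim_row ?M'" "j < dim_col ?M'"
      then have ij: "i < n" "j < n" by (auto simp: elimination_mat_def)
      then have "mat_delete N n n $$ (i, j) = N $$ (i, j)"
        using N by (simp add: mat_delete_def)
      also have "\<dots> = ?M' $$ (i, j)"
        unfolding idx[OF less_SucI less_SucI, OF ij] using ij q
        by (auto simp: elimination_mat_def adj adj_last)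
      finally show "mat_delete N n n $$ (i, j) = ?M' $$ (i, j)" .
    qed (use N in \<open>auto simp: elimination_mat_def mat_delete_def\<close>)
    then have "cofactor N n n = det ?M'"
      by (simp add: cofactor_def)
    then have "(\<Sum>i<Suc n. N $$ (i, n) * cofactor N i n) = d n * det ?M'"
      by (simp add: last)
    then show ?thesis
      using laplace_expansion_column[OF N, of n] by simp
  qed
  \<comment> \<open>Scaling row \<open>q\<close> and expanding produce the same factor
    \<open>d n\<close>, which cancels in a domain.\<close>
  ultimately show ?thesis
    using \<open>d n \<noteq> 0\<close> by (simp add: q_def)
qed

text \<open>The matrix xI - A is the starting point of the elimination, with \<open>[:0, 1:]\<close>
  as the variable x; the diagonal is x since there are no loops.\<close>

lemma graph_char_poly_parent_tree:
  assumes "parent_function n p"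
  shows "graph_char_poly (parent_tree n p) = det (elimination_mat n p (\<lambda>_. [:0, 1:]) (\<lambda>_. 1))"
proof -
  have "(i, i) \<notin> parcs (parent_tree n p)" for i
    using assms by (auto simp: parent_tree_def parent_function_def)
  moreover have [simp]: "pverts (parent_tree n p) = {..<n}"
    by (simp add: parent_tree_def)
  moreover have "sorted_list_of_set {..<n} = [0..<n]"
    by (simp add: lessThan_atLeast0)
  ultimately show ?thesis
    unfolding graph_char_poly_def char_poly_def
    by (intro arg_cong[of _ _ det] eq_matI)
      (auto simp: char_poly_matrix_def adjacency_matrix_def elimination_mat_def Let_def)
qed

lemma det_elimination_mat_1: "det (elimination_mat (Suc 0) p d s) = d 0"
  by (subst det_single) (auto simp: elimination_mat_def)

section \<open>The two trees\<close>

text \<open>A caterpillar: the path 0, 1, ..., 7 with two leaves at 0 and one each at 1 and 3, the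
  first, second and fourth path vertices.\<close>

definition even_parent :: "nat \<Rightarrow> nat" where
  "even_parent = (!) [0, 0, 1, 2, 3, 4, 5, 6, 3, 1, 0, 0]"

text \<open>A caterpillar: the path 9, 0, 1, ..., 6 with two leaves at 9 and one each at 2 and 3,
  the first, fourth and fifth path vertices.\<close>

definition odd_parent :: "nat \<Rightarrow> nat" where
  "odd_parent = (!) [0, 0, 1, 2, 3, 4, 5, 3, 2, 0, 9, 9]"

lemma even_parent_simps:
  "even_parent (Suc 0) = 0" "even_parent 2 = 1" "even_parent 3 = 2" "even_parent 4 = 3"
  "even_parent 5 = 4" "even_parent 6 = 5" "even_parent 7 = 6" "even_parent 8 = 3"
  "even_parent 9 = 1" "even_parent 10 = 0" "even_parent 11 = 0"
  by (simp_all add: even_parent_def)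

lemma odd_parent_simps:
  "odd_parent (Suc 0) = 0" "odd_parent 2 = 1" "odd_parent 3 = 2" "odd_parent 4 = 3"
  "odd_parent 5 = 4" "odd_parent 6 = 5" "odd_parent 7 = 3" "odd_parent 8 = 2"
  "odd_parent 9 = 0" "odd_parent 10 = 9" "odd_parent 11 = 9"
  by (simp_all add: odd_parent_def)

lemma less_12_cases:
  assumes "i < 12"
  obtains "i = 0" | "i = Suc 0" | "i = 2" | "i = 3" | "i = 4" | "i = 5" | "i = 6" | "i = 7"
    | "i = 8" | "i = 9" | "i = 10" | "i = (11::nat)"
proof -
  have "i \<in> set [0..<12]" using assms by simp
  also have "[0..<12] = [0, Suc 0, 2, 3, 4, 5, 6, 7, 8, 9, 10, 11]"
    by (simp add: upt_rec)
  finally show thesis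
    using that by auto
qed

lemma parent_function_even_parent: "parent_function 12 even_parent"
  unfolding parent_function_def by (auto elim!: less_12_cases simp: even_parent_simps)

lemma parent_function_odd_parent: "parent_function 12 odd_parent"
  unfolding parent_function_def by (auto elim!: less_12_cases simp: odd_parent_simps)

section \<open>The common characteristic polynomial\<close>

text \<open>The elimination computes with coefficient lists, constant term first.\<close>

lemma characteristic_polynomial_eq_pCons:
  "monom 1 12 - monom 11 10 + monom 42 8 - monom 66 6 + monom 39 4 - monom 6 2 =
     ([:0, 0, -6, 0, 39, 0, -66, 0, 42, 0, -11, 0, 1:] :: int poly)"
proof -
  have "monom a (Suc 0) = pCons 0 [:a:]"
    "monom a (numeral k) = pCons 0 (monom a (pred_numeral k))" for a :: int and k
    by (simp_all only: monom_Suc monom_0 numeral_eq_Suc)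
  then show ?thesis
    by simp
qed

lemma graph_char_poly_even_parent:
  "graph_char_poly (parent_tree 12 even_parent) =
     monom 1 12 - monom 11 10 + monom 42 8 - monom 66 6 + monom 39 4 - monom 6 2"
proof -
  note step = det_elimination_mat_Suc[OF parent_function_even_parent]
  show ?thesis
    unfolding graph_char_poly_parent_tree[OF parent_function_even_parent]
      characteristic_polynomial_eq_pCons
    \<comment> \<open>Vertices 11 down to 1 are eliminated, and the remaining diagonal entry is the
      polynomial. Folding \<open>numeral_2_eq_2\<close> makes the last step match the size 2 left by
      the one before.\<close>
    by (simp add: step[of 11, simplified] step[of 10, simplified] step[of 9, simplified]
        step[of 8, simplified] step[of 7, simplified] step[of 6, simplified]
        step[of 5, simplified] step[of 4, simplified] step[of 3, simplified]
        step[of 2, simplified] step[of 1, simplified, folded numeral_2_eq_2]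
        det_elimination_mat_1 even_parent_simps one_pCons del: pCons_one)
qed

lemma graph_char_poly_odd_parent:
  "graph_char_poly (parent_tree 12 odd_parent) =
     monom 1 12 - monom 11 10 + monom 42 8 - monom 66 6 + monom 39 4 - monom 6 2"
proof -
  note step = det_elimination_mat_Suc[OF parent_function_odd_parent]
  show ?thesis
    unfolding graph_char_poly_parent_tree[OF parent_function_odd_parent]
      characteristic_polynomial_eq_pCons
    by (simp add: step[of 11, simplified] step[of 10, simplified] step[of 9, simplified]
        step[of 8, simplified] step[of 7, simplified] step[of 6, simplified]
        step[of 5, simplified] step[of 4, simplified] step[of 3, simplified]
        step[of 2, simplified] step[of 1, simplified, folded numeral_2_eq_2]
        det_elimination_mat_1 odd_parent_simps one_pCons del: pCons_one)
qed

section \<open>The parities of the two trees\<close>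

lemma even_tree_even_parent: "even_tree (parent_tree 12 even_parent)"
proof -
  define t where "t = Node [Node [Node [Node [Node [Node [Node [Node []]]], Node []]],
    Node []], Node [], Node []]"
  \<comment> \<open>Entry \<open>i\<close> is the address in \<open>t\<close> of vertex
    \<open>i\<close>.\<close>
  define as :: "nat list list" where "as =
    [[], [0], [0, 0], [0, 0, 0], [0, 0, 0, 0], [0, 0, 0, 0, 0], [0, 0, 0, 0, 0, 0],
      [0, 0, 0, 0, 0, 0, 0], [0, 0, 0, 1], [0, 1], [1], [2]]"
  have [simp]: "length as = 12"
    by (simp add: as_def)
  have "addresses t = set as"
    unfolding t_def as_def by (simp add: lessThan_Suc numeral_2_eq_2 insert_commute)
  moreover have "distinct as" "as ! 0 = []"
    by (simp_all add: as_def)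
  moreover have "as ! i \<noteq> [] \<and> butlast (as ! i) = as ! even_parent i" if "0 < i" "i < 12" for i
    using that(2,1) by (cases rule: less_12_cases) (simp_all add: even_parent_simps as_def)
  ultimately have rooting: "plane_rooting t (parent_tree 12 even_parent)"
    using plane_rooting_parent_tree_list[of as even_parent t] parent_function_even_parent by simp
  \<comment> \<open>The vertices at odd depth below the root 0.\<close>
  define C :: "nat set" where "C = {1, 3, 5, 7, 10, 11}"
  have "(i \<in> C) \<noteq> (even_parent i \<in> C)" if "0 < i" "i < 12" for i
    using that(2,1) by (cases rule: less_12_cases) (simp_all add: even_parent_simps C_def)
  then have colouring: "(u \<in> C) \<noteq> (v \<in> C)" if "(u, v) \<in> parcs (parent_tree 12 even_parent)" for u v
    by (rule parent_tree_proper_colouring[OF _ that])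
  have "{v \<in> {..<12}. v \<in> C} = C"
    by (auto simp: C_def)
  moreover have "card C = 6"
    by (simp add: C_def)
  moreover have "pverts (parent_tree 12 even_parent) = {..<12}"
    by (simp add: parent_tree_def)
  ultimately show ?thesis
    \<comment> \<open>C(12,2) = 66 and the class size 6 are both even.\<close>
    using even_tree_iff[OF rooting colouring] by (simp add: choose_two)
qed

lemma odd_tree_odd_parent: "odd_tree (parent_tree 12 odd_parent)"
proof -
  define t where "t = Node [Node [Node [Node [Node [Node [Node []]], Node []], Node []]], Node [Node [], Node []]]"
  define as :: "nat list list" where "as =
    [[], [0], [0, 0], [0, 0, 0], [0, 0, 0, 0], [0, 0, 0, 0, 0], [0, 0, 0, 0, 0, 0],
      [0, 0, 0, 1], [0, 0, 1], [1], [1, 0], [1, 1]]"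
  have [simp]: "length as = 12"
    by (simp add: as_def)
  have "addresses t = set as"
    unfolding t_def as_def by (simp add: lessThan_Suc numeral_2_eq_2 insert_commute)
  moreover have "distinct as" "as ! 0 = []"
    by (simp_all add: as_def)
  moreover have "as ! i \<noteq> [] \<and> butlast (as ! i) = as ! odd_parent i" if "0 < i" "i < 12" for i
    using that(2,1) by (cases rule: less_12_cases) (simp_all add: odd_parent_simps as_def)
  ultimately have rooting: "plane_rooting t (parent_tree 12 odd_parent)"
    using plane_rooting_parent_tree_list[of as odd_parent t] parent_function_odd_parent by simp
  \<comment> \<open>Again the vertices at odd depth.\<close>
  define C :: "nat set" where "C = {1, 3, 5, 8, 9}"
  have "(i \<in> C) \<noteq> (odd_parent i \<in> C)" if "0 < i" "i < 12" for i
    using that(2,1) by (cases rule: less_12_cases) (simp_all add: odd_parent_simps C_def)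
  then have colouring: "(u \<in> C) \<noteq> (v \<in> C)" if "(u, v) \<in> parcs (parent_tree 12 odd_parent)" for u v
    by (rule parent_tree_proper_colouring[OF _ that])
  have "{v \<in> {..<12}. v \<in> C} = C"
    by (auto simp: C_def)
  moreover have "card C = 5"
    by (simp add: C_def)
  moreover have "pverts (parent_tree 12 odd_parent) = {..<12}"
    by (simp add: parent_tree_def)
  ultimately show ?thesis
    \<comment> \<open>Now 66 is even but the class size 5 is odd.\<close>
    using odd_tree_iff[OF rooting colouring] by (simp add: choose_two)
qed

theorem mainTheorem8:
  shows "\<exists>(T\<^sub>1 :: nat pair_pre_digraph) (T\<^sub>2 :: nat pair_pre_digraph).
    cospectral_trees T\<^sub>1 T\<^sub>2 \<and>
    card (pverts T\<^sub>1) = 12 \<and> card (pverts T\<^sub>2) = 12 \<and>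
    graph_char_poly T\<^sub>1 =
      monom 1 12 - monom 11 10 + monom 42 8 - monom 66 6 + monom 39 4 - monom 6 2 \<and>
    graph_char_poly T\<^sub>2 =
      monom 1 12 - monom 11 10 + monom 42 8 - monom 66 6 + monom 39 4 - monom 6 2 \<and>
    even_tree T\<^sub>1 \<and> odd_tree T\<^sub>2"
proof (intro exI conjI)
  show "cospectral_trees (parent_tree 12 even_parent) (parent_tree 12 odd_parent)"
    unfolding cospectral_trees_def graph_char_poly_even_parent graph_char_poly_odd_parent
    using undirected_tree_parent_tree[OF parent_function_even_parent]
      undirected_tree_parent_tree[OF parent_function_odd_parent]
      not_digraph_iso_even_odd[OF even_tree_even_parent odd_tree_odd_parent] by simp
  show "card (pverts (parent_tree 12 even_parent)) = 12"
    "card (pverts (parent_tree 12 odd_parent)) = 12"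
    by (simp_all add: parent_tree_def)
qed (fact graph_char_poly_even_parent graph_char_poly_odd_parent
      even_tree_even_parent odd_tree_odd_parent)+

end
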